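(* Let $k$ be a field and let $P_3\subset P_4$ be the free (unital) Poisson algebras over $k$ with free generating sets $\{x_1,x_2,x_3\}$ and $\{x_1,x_2,x_3,x_4\}$. Let $\delta$ be the automorphism of $P_3$ given by $$\delta=\bigl(x_1+[x_3,\,x_1x_3-[x_3,x_2]],\ \ x_2+(x_1x_3-[x_3,x_2])x_3,\ \ x_3\bigr).$$ Then $\delta$ is stably tame: its extension $(\delta(x_1),\delta(x_2),x_3,x_4)$ to $P_4$ is a tame automorphism of $P_4$.
   Context: A Poisson algebra over a field $k$ is a $k$-vector space with a commutative associative product $\cdot$ and a Lie bracket $[-,-]$ satisfying the Leibniz identity $[x,y\cdot z]=y\cdot[x,z]+z\cdot[x,y]$. All Poisson algebras are assumed unital (the commutative product has a unit). $P_n$ denotes the free Poisson algebra over $k$ on $X=\{x_1,\dots,x_n\}$. The notation $(f_1,\dots,f_n)$ denotes the endomorphism of $P_n$ sending $x_i$ to $f_i$ for all $i$. An elementary automorphism is one of the form $\sigma(i,\alpha,f)=(x_1,\dots,x_{i-1},\alpha x_i+f,x_{i+1},\dots,x_n)$ with $1\le i\le n$, $0\neq\alpha\in k$ and $f$ in the Poisson subalgebra generated by $X\setminus\{x_i\}$. An automorphism of $P_n$ is tame if it lies in the subgroup $\mathsf{TA}(P_n)$ of $\mathsf{Aut}(P_n)$ generated by all elementary automorphisms. *)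

theory Defs
  imports Complex_Main "HOL-Library.Numeral_Type" "HOL-Algebra.Generated_Groups"
begin

section \<open>Poisson algebras\<close>

text \<open>Lie brackets are required to be alternating, not merely antisymmetric, so that the
  notion is the usual one over fields of characteristic 2 as well.\<close>

locale poisson_algebra = vector_space scale
  for scale :: "'k::field \<Rightarrow> 'a::comm_ring_1 \<Rightarrow> 'a" (infixr "*s" 75) +
  fixes bracket :: "'a \<Rightarrow> 'a \<Rightarrow> 'a" ("[_, _]\<^sub>L")
  assumes scale_mult: "(c *s x) * y = c *s (x * y)"
    and bracket_add_left: "[x + y, z]\<^sub>L = [x, z]\<^sub>L + [y, z]\<^sub>L"
    and bracket_add_right: "[x, y + z]\<^sub>L = [x, y]\<^sub>L + [x, z]\<^sub>L"
    and bracket_scale_left: "[c *s x, y]\<^sub>L = c *s [x, y]\<^sub>L"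
    and bracket_scale_right: "[x, c *s y]\<^sub>L = c *s [x, y]\<^sub>L"
    and bracket_self: "[x, x]\<^sub>L = 0"
    and jacobi: "[x, [y, z]\<^sub>L]\<^sub>L + [y, [z, x]\<^sub>L]\<^sub>L + [z, [x, y]\<^sub>L]\<^sub>L = 0"
    and leibniz: "[x, y * z]\<^sub>L = y * [x, z]\<^sub>L + z * [x, y]\<^sub>L"

definition poisson_hom ::
    "('k::field \<Rightarrow> 'a::comm_ring_1 \<Rightarrow> 'a) \<Rightarrow> ('a \<Rightarrow> 'a \<Rightarrow> 'a) \<Rightarrow>
     ('k \<Rightarrow> 'b::comm_ring_1 \<Rightarrow> 'b) \<Rightarrow> ('b \<Rightarrow> 'b \<Rightarrow> 'b) \<Rightarrow> ('a \<Rightarrow> 'b) \<Rightarrow> bool" where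
  "poisson_hom s1 b1 s2 b2 \<phi> \<longleftrightarrow>
     Vector_Spaces.linear s1 s2 \<phi> \<and> \<phi> 1 = 1 \<and>
     (\<forall>x y. \<phi> (x * y) = \<phi> x * \<phi> y) \<and> (\<forall>x y. \<phi> (b1 x y) = b2 (\<phi> x) (\<phi> y))"


section \<open>The free Poisson algebra over a field on a type of generators\<close>

text \<open>Terms in the signature of unital Poisson algebras, modulo the congruence generated by
  the axioms.\<close>

datatype ('k, 'x) pterm =
    Var 'x
  | Zero
  | One
  | Add "('k, 'x) pterm" "('k, 'x) pterm"
  | Scale 'k "('k, 'x) pterm"
  | Mult "('k, 'x) pterm" "('k, 'x) pterm"
  | Bracket "('k, 'x) pterm" "('k, 'x) pterm"

inductive pcong :: "('k::field, 'x) pterm \<Rightarrow> ('k, 'x) pterm \<Rightarrow> bool" (infix "\<approx>" 50) where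
  refl: "t \<approx> t"
| sym: "t \<approx> u \<Longrightarrow> u \<approx> t"
| trans: "t \<approx> u \<Longrightarrow> u \<approx> v \<Longrightarrow> t \<approx> v"
| cong_Add: "t \<approx> t' \<Longrightarrow> u \<approx> u' \<Longrightarrow> Add t u \<approx> Add t' u'"
| cong_Scale: "t \<approx> t' \<Longrightarrow> Scale c t \<approx> Scale c t'"
| cong_Mult: "t \<approx> t' \<Longrightarrow> u \<approx> u' \<Longrightarrow> Mult t u \<approx> Mult t' u'"
| cong_Bracket: "t \<approx> t' \<Longrightarrow> u \<approx> u' \<Longrightarrow> Bracket t u \<approx> Bracket t' u'"
| add_assoc: "Add (Add t u) v \<approx> Add t (Add u v)"
| add_comm: "Add t u \<approx> Add u t"
| add_zero: "Add Zero t \<approx> t"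
| add_neg: "Add (Scale (-1) t) t \<approx> Zero"
| scale_add_right: "Scale c (Add t u) \<approx> Add (Scale c t) (Scale c u)"
| scale_add_left: "Scale (c + d) t \<approx> Add (Scale c t) (Scale d t)"
| scale_scale: "Scale c (Scale d t) \<approx> Scale (c * d) t"
| scale_one: "Scale 1 t \<approx> t"
| mult_assoc: "Mult (Mult t u) v \<approx> Mult t (Mult u v)"
| mult_comm: "Mult t u \<approx> Mult u t"
| mult_one: "Mult One t \<approx> t"
| mult_add: "Mult (Add t u) v \<approx> Add (Mult t v) (Mult u v)"
| mult_scale: "Mult (Scale c t) u \<approx> Scale c (Mult t u)"
| bracket_add_left: "Bracket (Add t u) v \<approx> Add (Bracket t v) (Bracket u v)"
| bracket_add_right: "Bracket t (Add u v) \<approx> Add (Bracket t u) (Bracket t v)"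
| bracket_scale_left: "Bracket (Scale c t) u \<approx> Scale c (Bracket t u)"
| bracket_scale_right: "Bracket t (Scale c u) \<approx> Scale c (Bracket t u)"
| bracket_self: "Bracket t t \<approx> Zero"
| jacobi: "Add (Add (Bracket t (Bracket u v)) (Bracket u (Bracket v t))) (Bracket v (Bracket t u))
      \<approx> Zero"
| leibniz: "Bracket t (Mult u v) \<approx> Add (Mult u (Bracket t v)) (Mult v (Bracket t u))"

primrec peval :: "('k \<Rightarrow> 'a::comm_ring_1 \<Rightarrow> 'a) \<Rightarrow> ('a \<Rightarrow> 'a \<Rightarrow> 'a) \<Rightarrow> ('x \<Rightarrow> 'a) \<Rightarrow> ('k, 'x) pterm \<Rightarrow> 'a" where
  "peval s b f (Var x) = f x"
| "peval s b f Zero = 0"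
| "peval s b f One = 1"
| "peval s b f (Add t u) = peval s b f t + peval s b f u"
| "peval s b f (Scale c t) = s c (peval s b f t)"
| "peval s b f (Mult t u) = peval s b f t * peval s b f u"
| "peval s b f (Bracket t u) = b (peval s b f t) (peval s b f u)"

lemma (in poisson_algebra) peval_cong:
  "t \<approx> u \<Longrightarrow> peval scale bracket f t = peval scale bracket f u"
proof (induction rule: pcong.induct)
  case (jacobi t u v)
  show ?case by (simp add: poisson_algebra.jacobi[OF poisson_algebra_axioms])
next
  case (leibniz t u v)
  show ?case by (simp add: poisson_algebra.leibniz[OF poisson_algebra_axioms])
next
  case (mult_add t u v)
  show ?case by (simp add: distrib_right)
next
  case (mult_scale c t u)
  show ?case by (simp add: scale_mult)
qed (simp_all add: ac_simps bracket_add_left bracket_add_right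
      bracket_scale_left bracket_scale_right bracket_self scale_right_distrib scale_left_distrib)

quotient_type (overloaded) ('k, 'x) free_poisson = "('k::field, 'x) pterm" / pcong
  by (rule equivpI) (auto intro!: reflpI sympI transpI intro: pcong.refl pcong.sym pcong.trans)

lift_definition gen :: "'x \<Rightarrow> ('k::field, 'x) free_poisson" is Var .

lift_definition pscale :: "'k \<Rightarrow> ('k::field, 'x) free_poisson \<Rightarrow> ('k, 'x) free_poisson"
  (infixr "*\<^sub>k" 75) is Scale by (rule pcong.cong_Scale)

lift_definition pbracket ::
  "('k::field, 'x) free_poisson \<Rightarrow> ('k, 'x) free_poisson \<Rightarrow> ('k, 'x) free_poisson"
  ("\<lbrace>_, _\<rbrace>") is Bracket by (rule pcong.cong_Bracket)

interpretation ground: poisson_algebra "(*) :: 'k::field \<Rightarrow> 'k \<Rightarrow> 'k" "\<lambda>_ _. 0"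
  by unfold_locales (auto simp: algebra_simps)

instantiation free_poisson :: (field, type) comm_ring_1
begin

lift_definition zero_free_poisson :: "('a, 'b) free_poisson" is Zero .
lift_definition one_free_poisson :: "('a, 'b) free_poisson" is One .
lift_definition plus_free_poisson ::
  "('a, 'b) free_poisson \<Rightarrow> ('a, 'b) free_poisson \<Rightarrow> ('a, 'b) free_poisson" is Add
  by (rule pcong.cong_Add)
lift_definition times_free_poisson ::
  "('a, 'b) free_poisson \<Rightarrow> ('a, 'b) free_poisson \<Rightarrow> ('a, 'b) free_poisson" is Mult
  by (rule pcong.cong_Mult)
lift_definition uminus_free_poisson :: "('a, 'b) free_poisson \<Rightarrow> ('a, 'b) free_poisson" is "Scale (-1)"
  by (rule pcong.cong_Scale)
definition minus_free_poisson ::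
  "('a, 'b) free_poisson \<Rightarrow> ('a, 'b) free_poisson \<Rightarrow> ('a, 'b) free_poisson" where
  "minus_free_poisson x y = x + - y"

instance
proof
  fix a b c :: "('a, 'b) free_poisson"
  show "a + b + c = a + (b + c)" by transfer (rule pcong.add_assoc)
  show "a + b = b + a" by transfer (rule pcong.add_comm)
  show "0 + a = a" by transfer (rule pcong.add_zero)
  show "- a + a = 0" by transfer (rule pcong.add_neg)
  show "a - b = a + - b" by (rule minus_free_poisson_def)
  show "a * b * c = a * (b * c)" by transfer (rule pcong.mult_assoc)
  show "a * b = b * a" by transfer (rule pcong.mult_comm)
  show "1 * a = a" by transfer (rule pcong.mult_one)
  show "(a + b) * c = a * c + b * c" by transfer (rule pcong.mult_add)
  show "(0 :: ('a, 'b) free_poisson) \<noteq> 1"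
  proof transfer
    show "\<not> (Zero :: ('a, 'b) pterm) \<approx> One"
      using ground.peval_cong[of "Zero :: ('a, 'b) pterm" One "\<lambda>_. 0"] by auto
  qed
qed

end

interpretation free_poisson: poisson_algebra
  "(*\<^sub>k) :: 'k::field \<Rightarrow> ('k, 'x) free_poisson \<Rightarrow> ('k, 'x) free_poisson" pbracket
proof
  fix a b :: 'k and x y z :: "('k, 'x) free_poisson"
  show "a *\<^sub>k (x + y) = a *\<^sub>k x + a *\<^sub>k y" by transfer (rule pcong.scale_add_right)
  show "(a + b) *\<^sub>k x = a *\<^sub>k x + b *\<^sub>k x" by transfer (rule pcong.scale_add_left)
  show "a *\<^sub>k b *\<^sub>k x = (a * b) *\<^sub>k x" by transfer (rule pcong.scale_scale)
  show "1 *\<^sub>k x = x" by transfer (rule pcong.scale_one)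
  show "(a *\<^sub>k x) * y = a *\<^sub>k (x * y)" by transfer (rule pcong.mult_scale)
  show "\<lbrace>x + y, z\<rbrace> = \<lbrace>x, z\<rbrace> + \<lbrace>y, z\<rbrace>" by transfer (rule pcong.bracket_add_left)
  show "\<lbrace>x, y + z\<rbrace> = \<lbrace>x, y\<rbrace> + \<lbrace>x, z\<rbrace>" by transfer (rule pcong.bracket_add_right)
  show "\<lbrace>a *\<^sub>k x, y\<rbrace> = a *\<^sub>k \<lbrace>x, y\<rbrace>" by transfer (rule pcong.bracket_scale_left)
  show "\<lbrace>x, a *\<^sub>k y\<rbrace> = a *\<^sub>k \<lbrace>x, y\<rbrace>" by transfer (rule pcong.bracket_scale_right)
  show "\<lbrace>x, x\<rbrace> = 0" by transfer (rule pcong.bracket_self)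
  show "\<lbrace>x, \<lbrace>y, z\<rbrace>\<rbrace> + \<lbrace>y, \<lbrace>z, x\<rbrace>\<rbrace> + \<lbrace>z, \<lbrace>x, y\<rbrace>\<rbrace> = 0" by transfer (rule pcong.jacobi)
  show "\<lbrace>x, y * z\<rbrace> = y * \<lbrace>x, z\<rbrace> + z * \<lbrace>x, y\<rbrace>" by transfer (rule pcong.leibniz)
qed

text \<open>The homomorphism with prescribed values on the generators; freeness is the lemma
  \<open>free_poisson_universal\<close>.\<close>

definition hom_ext :: "('k::field \<Rightarrow> 'a::comm_ring_1 \<Rightarrow> 'a) \<Rightarrow> ('a \<Rightarrow> 'a \<Rightarrow> 'a) \<Rightarrow> ('x \<Rightarrow> 'a) \<Rightarrow>
    ('k, 'x) free_poisson \<Rightarrow> 'a" where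
  "hom_ext s b f p = peval s b f (rep_free_poisson p)"

lemma free_poisson_induct [case_names gen zero one add scale mult bracket]:
  assumes "\<And>i. P (gen i)" "P 0" "P 1" "\<And>x y. P x \<Longrightarrow> P y \<Longrightarrow> P (x + y)"
    "\<And>c x. P x \<Longrightarrow> P (c *\<^sub>k x)" "\<And>x y. P x \<Longrightarrow> P y \<Longrightarrow> P (x * y)"
    "\<And>x y. P x \<Longrightarrow> P y \<Longrightarrow> P \<lbrace>x, y\<rbrace>"
  shows "P p"
proof -
  obtain t where p: "p = abs_free_poisson t"
    by (metis Quotient3_free_poisson Quotient3_abs_rep)
  have "P (abs_free_poisson t)"
  proof (induction t)
    case (Var i)
    show ?case using assms(1)[of i] by (simp add: gen.abs_eq)
  next
    case Zero
    show ?case using assms(2) by (simp add: zero_free_poisson.abs_eq)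
  next
    case One
    show ?case using assms(3) by (simp add: one_free_poisson.abs_eq)
  next
    case (Add t u)
    show ?case using assms(4)[OF Add] by (simp add: plus_free_poisson.abs_eq)
  next
    case (Scale c t)
    show ?case using assms(5)[OF Scale] by (simp add: pscale.abs_eq)
  next
    case (Mult t u)
    show ?case using assms(6)[OF Mult] by (simp add: times_free_poisson.abs_eq)
  next
    case (Bracket t u)
    show ?case using assms(7)[OF Bracket] by (simp add: pbracket.abs_eq)
  qed
  then show ?thesis by (simp add: p)
qed

context poisson_algebra
begin

lemma hom_ext_abs: "hom_ext scale bracket f (abs_free_poisson t) = peval scale bracket f t"
  unfolding hom_ext_def
  by (rule peval_cong) (rule Quotient3_rep_abs[OF Quotient3_free_poisson pcong.refl])

lemma hom_ext_simps [simp]: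
  "hom_ext scale bracket f (gen i) = f i"
  "hom_ext scale bracket f 0 = 0"
  "hom_ext scale bracket f 1 = 1"
  "hom_ext scale bracket f (p + q) = hom_ext scale bracket f p + hom_ext scale bracket f q"
  "hom_ext scale bracket f (c *\<^sub>k p) = c *s hom_ext scale bracket f p"
  "hom_ext scale bracket f (p * q) = hom_ext scale bracket f p * hom_ext scale bracket f q"
  "hom_ext scale bracket f \<lbrace>p, q\<rbrace> = bracket (hom_ext scale bracket f p) (hom_ext scale bracket f q)"
proof -
  obtain t u where [simp]: "p = abs_free_poisson t" "q = abs_free_poisson u"
    by (metis Quotient3_free_poisson Quotient3_abs_rep)
  note abs_eqs = gen.abs_eq zero_free_poisson.abs_eq one_free_poisson.abs_eq
    plus_free_poisson.abs_eq pscale.abs_eq times_free_poisson.abs_eq pbracket.abs_eq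
  show "hom_ext scale bracket f (gen i) = f i"
    "hom_ext scale bracket f 0 = 0"
    "hom_ext scale bracket f 1 = 1"
    "hom_ext scale bracket f (p + q) = hom_ext scale bracket f p + hom_ext scale bracket f q"
    "hom_ext scale bracket f (c *\<^sub>k p) = c *s hom_ext scale bracket f p"
    "hom_ext scale bracket f (p * q) = hom_ext scale bracket f p * hom_ext scale bracket f q"
    "hom_ext scale bracket f \<lbrace>p, q\<rbrace> =
       bracket (hom_ext scale bracket f p) (hom_ext scale bracket f q)"
    by (simp_all add: abs_eqs hom_ext_abs)
qed

lemma poisson_hom_hom_ext: "poisson_hom (*\<^sub>k) pbracket scale bracket (hom_ext scale bracket f)"
  unfolding poisson_hom_def
  by (simp add: Vector_Spaces.linear_iff free_poisson.vector_space_axioms vector_space_axioms)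

lemma hom_ext_unique:
  assumes "poisson_hom (*\<^sub>k) pbracket scale bracket \<phi>" "\<And>i. \<phi> (gen i) = f i"
  shows "\<phi> = hom_ext scale bracket f"
proof
  interpret \<phi>: Vector_Spaces.linear "(*\<^sub>k)" scale \<phi>
    using assms(1) by (simp add: poisson_hom_def)
  fix p show "\<phi> p = hom_ext scale bracket f p"
    by (induction p rule: free_poisson_induct)
      (use assms in \<open>auto simp: poisson_hom_def \<phi>.add \<phi>.scale \<phi>.zero\<close>)
qed

theorem free_poisson_universal:
  "\<exists>!\<phi>. poisson_hom (*\<^sub>k) pbracket scale bracket \<phi> \<and> (\<forall>i. \<phi> (gen i) = f i)"
proof (rule ex1I)
  show "poisson_hom (*\<^sub>k) pbracket scale bracket (hom_ext scale bracket f) \<and>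
      (\<forall>i. hom_ext scale bracket f (gen i) = f i)"
    by (simp add: poisson_hom_hom_ext)
qed (simp add: hom_ext_unique)

end

abbreviation free_hom :: "('x \<Rightarrow> ('k::field, 'y) free_poisson) \<Rightarrow> ('k, 'x) free_poisson \<Rightarrow> ('k, 'y) free_poisson"
  where "free_hom \<equiv> hom_ext (*\<^sub>k) pbracket"


section \<open>Automorphisms\<close>

definition Aut_P :: "(('k::field, 'x) free_poisson \<Rightarrow> ('k, 'x) free_poisson) monoid" where
  "Aut_P = \<lparr>carrier = {\<phi>. poisson_hom (*\<^sub>k) pbracket (*\<^sub>k) pbracket \<phi> \<and> bij \<phi>},
            monoid.mult = (\<circ>), one = id\<rparr>"

definition poisson_subalgebra :: "('k::field, 'x) free_poisson set \<Rightarrow> bool" where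
  "poisson_subalgebra A \<longleftrightarrow> module.subspace (*\<^sub>k) A \<and> 1 \<in> A \<and>
     (\<forall>x\<in>A. \<forall>y\<in>A. x * y \<in> A \<and> \<lbrace>x, y\<rbrace> \<in> A)"

definition elementary ::
    "'x \<Rightarrow> 'k \<Rightarrow> ('k, 'x) free_poisson \<Rightarrow> ('k::field, 'x) free_poisson \<Rightarrow> ('k, 'x) free_poisson" where
  "elementary i \<alpha> f = free_hom (gen(i := \<alpha> *\<^sub>k gen i + f))"

definition elementary_auts :: "(('k::field, 'x) free_poisson \<Rightarrow> ('k, 'x) free_poisson) set" where
  "elementary_auts =
     {elementary i \<alpha> f | i \<alpha> f. \<alpha> \<noteq> 0 \<and> f \<in> poisson_subalgebra hull (gen ` (UNIV - {i}))}"

definition tame_auts :: "(('k::field, 'x) free_poisson \<Rightarrow> ('k, 'x) free_poisson) set" where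
  "tame_auts = generate Aut_P elementary_auts"


lemma group_Aut_P: "group Aut_P"
proof (rule groupI)
  fix \<phi> :: "('k::field, 'x) free_poisson \<Rightarrow> ('k, 'x) free_poisson"
  assume \<phi>: "\<phi> \<in> carrier Aut_P"
  then have bij: "bij \<phi>" and hom: "poisson_hom (*\<^sub>k) pbracket (*\<^sub>k) pbracket \<phi>"
    by (auto simp: Aut_P_def)
  have inv_eqI: "inv_into UNIV \<phi> y = x" if "\<phi> x = y" for x y
    using that bij by (simp add: bij_is_inj inv_f_eq)
  have f_inv: "\<phi> (inv_into UNIV \<phi> y) = y" for y
    using bij by (simp add: bij_is_surj surj_f_inv_f)
  have "poisson_hom (*\<^sub>k) pbracket (*\<^sub>k) pbracket (inv_into UNIV \<phi>)"
    using hom unfolding poisson_hom_def Vector_Spaces.linear_iff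
    by (auto intro!: inv_eqI simp: f_inv)
  then show "\<exists>\<psi>\<in>carrier Aut_P. \<psi> \<otimes>\<^bsub>Aut_P\<^esub> \<phi> = \<one>\<^bsub>Aut_P\<^esub>"
    using bij by (intro bexI[of _ "inv_into UNIV \<phi>"])
      (auto simp: Aut_P_def bij_imp_bij_inv bij_is_inj)
qed (auto simp: Aut_P_def poisson_hom_def Vector_Spaces.linear_iff bij_comp comp_assoc
    free_poisson.vector_space_axioms)

lemma elementary_auts_subset: "elementary_auts \<subseteq> carrier Aut_P"
proof
  fix \<phi> :: "('k::field, 'x) free_poisson \<Rightarrow> ('k, 'x) free_poisson"
  assume "\<phi> \<in> elementary_auts"
  then obtain i \<alpha> f where \<phi>: "\<phi> = elementary i \<alpha> f" and \<alpha>: "\<alpha> \<noteq> 0"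
    and f: "f \<in> poisson_subalgebra hull (gen ` (UNIV - {i}))"
    by (auto simp: elementary_auts_def)
  have fix_f: "elementary i \<beta> g f = f" for \<beta> and g :: "('k, 'x) free_poisson"
  proof -
    have "poisson_subalgebra {p. elementary i \<beta> g p = p}"
      by (simp add: poisson_subalgebra_def free_poisson.subspace_def elementary_def)
    moreover have "gen ` (UNIV - {i}) \<subseteq> {p. elementary i \<beta> g p = p}"
      by (auto simp: elementary_def)
    ultimately show ?thesis
      using f by (auto simp: hull_def)
  qed
  define \<psi> where "\<psi> = elementary i (inverse \<alpha>) (- (inverse \<alpha> *\<^sub>k f))"
  have minus: "elementary i \<beta> g (- p) = - elementary i \<beta> g p"
    "elementary i \<beta> g (p - q) = elementary i \<beta> g p - elementary i \<beta> g q" for \<beta> and g p q :: "('k, 'x) free_poisson"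
    unfolding elementary_def
    by (metis add.right_inverse free_poisson.hom_ext_simps(2,4) minus_unique)
      (metis diff_add_cancel eq_diff_eq free_poisson.hom_ext_simps(4))
  have ef: "elementary i \<beta> g (gen j) = (if j = i then \<beta> *\<^sub>k gen i + g else gen j)" for \<beta> g j
    by (simp add: elementary_def)
  have es: "elementary i \<beta> g (p + q) = elementary i \<beta> g p + elementary i \<beta> g q"
    "elementary i \<beta> g (c *\<^sub>k p) = c *\<^sub>k elementary i \<beta> g p" for \<beta> c and g p q :: "('k, 'x) free_poisson"
    by (simp_all add: elementary_def)
  have 1: "\<phi> (\<psi> (gen j)) = gen j" for j
    using \<alpha> by (simp add: \<phi> \<psi>_def ef es minus fix_f free_poisson.scale_right_distrib
        free_poisson.scale_right_diff_distrib)
  have 2: "\<psi> (\<phi> (gen j)) = gen j" for j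
    using \<alpha> by (simp add: \<phi> \<psi>_def ef es minus fix_f free_poisson.scale_right_distrib
        free_poisson.scale_right_diff_distrib)
  have "\<phi> (\<psi> p) = p" for p
  proof (induction p rule: free_poisson_induct)
    case (gen j)
    show ?case by (rule 1)
  qed (simp_all add: \<phi> \<psi>_def elementary_def)
  moreover have "\<psi> (\<phi> p) = p" for p
  proof (induction p rule: free_poisson_induct)
    case (gen j)
    show ?case by (rule 2)
  qed (simp_all add: \<phi> \<psi>_def elementary_def)
  ultimately have "bij \<phi>"
    by (intro o_bij[of \<psi>]) auto
  then show "\<phi> \<in> carrier Aut_P"
    by (simp add: Aut_P_def \<phi> elementary_def free_poisson.poisson_hom_hom_ext)
qed

lemma tame_auts_subgroup: "subgroup tame_auts Aut_P"
  unfolding tame_auts_def by (rule group.generate_is_subgroup[OF group_Aut_P elementary_auts_subset])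


section \<open>Three and four generators\<close>

text \<open>The generators $x_i$ are indexed by the numeral types 3 and 4, whose elements are
  \<open>1, 2, 3\<close> and \<open>1, 2, 3, 4\<close>; arithmetic in these types is modular, so the last one is also
  written \<open>0\<close>.\<close>

lemma exhaust_index3: "i = 1 \<or> i = 2 \<or> i = (3::3)"
proof (induct i)
  case (of_int z)
  then have "z = 0 \<or> z = 1 \<or> z = 2" by fastforce
  then show ?case by auto
qed

lemma exhaust_index4: "i = 1 \<or> i = 2 \<or> i = 3 \<or> i = (4::4)"
proof (induct i)
  case (of_int z)
  then have "z = 0 \<or> z = 1 \<or> z = 2 \<or> z = 3" by fastforce
  then show ?case by auto
qed

definition tuple3 :: "'a \<Rightarrow> 'a \<Rightarrow> 'a \<Rightarrow> 3 \<Rightarrow> 'a" where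
  "tuple3 a b c i = (if i = 1 then a else if i = 2 then b else c)"

definition tuple4 :: "'a \<Rightarrow> 'a \<Rightarrow> 'a \<Rightarrow> 'a \<Rightarrow> 4 \<Rightarrow> 'a" where
  "tuple4 a b c d i = (if i = 1 then a else if i = 2 then b else if i = 3 then c else d)"

lemma tuple3_simps [simp]: "tuple3 a b c 1 = a" "tuple3 a b c 2 = b" "tuple3 a b c 3 = c"
  by (auto simp: tuple3_def)

lemma tuple4_simps [simp]:
  "tuple4 a b c d 1 = a" "tuple4 a b c d 2 = b" "tuple4 a b c d 3 = c" "tuple4 a b c d 4 = d"
  by (auto simp: tuple4_def)

definition incl :: "('k::field, 3) free_poisson \<Rightarrow> ('k, 4) free_poisson" where
  "incl = free_hom (tuple3 (gen 1) (gen 2) (gen 3))"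

lemma inj_incl: "inj (incl :: ('k::field, 3) free_poisson \<Rightarrow> ('k, 4) free_poisson)"
proof (rule inj_on_inverseI)
  fix p :: "('k, 3) free_poisson"
  show "free_hom (tuple4 (gen 1) (gen 2) (gen 3) 0) (incl p) = p"
  proof (induction p rule: free_poisson_induct)
    case (gen i)
    then show ?case using exhaust_index3[of i] by (auto simp: incl_def)
  qed (simp_all add: incl_def)
qed

end

theory Submission
  imports Defs
begin

text \<open>
  Put \<open>w = x\<^sub>1 x\<^sub>3 - [x\<^sub>3, x\<^sub>2]\<close>.  For any \<open>c\<close>, the substitution
  \<open>x\<^sub>1 \<mapsto> x\<^sub>1 + [x\<^sub>3, c]\<close>, \<open>x\<^sub>2 \<mapsto> x\<^sub>2 + c x\<^sub>3\<close>, \<open>x\<^sub>3 \<mapsto> x\<^sub>3\<close> fixes \<open>w\<close>, because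
  \<open>[x\<^sub>3, c x\<^sub>3] = [x\<^sub>3, c] x\<^sub>3\<close> by the Leibniz rule (lemma \<open>twist_invariant\<close>).  Taking \<open>c = w\<close>
  gives \<open>\<delta>\<close>, so \<open>\<delta>\<close> fixes \<open>w\<close> and the substitution for \<open>c = -w\<close> is its inverse.

  For stable tameness the new variable \<open>x\<^sub>4\<close> plays the role of \<open>c\<close>.  The automorphism \<open>\<psi>\<close>
  obtained from \<open>c = x\<^sub>4\<close> is a product of two elementary ones, since \<open>[x\<^sub>3, x\<^sub>4]\<close> and
  \<open>x\<^sub>4 x\<^sub>3\<close> involve neither \<open>x\<^sub>1\<close> nor \<open>x\<^sub>2\<close>; and \<open>\<rho>: x\<^sub>4 \<mapsto> x\<^sub>4 + w\<close> is elementary.  As \<open>\<psi>\<close>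
  fixes \<open>w\<close>, the commutator \<open>\<psi>\<inverse> \<rho> \<psi> \<rho>\<inverse>\<close> is the extension of \<open>\<delta>\<close>: in
  \<open>\<psi>\<inverse> \<rho> \<psi>\<close> the increment \<open>x\<^sub>4\<close> becomes \<open>x\<^sub>4 + w\<close> and the contribution of \<open>x\<^sub>4\<close> cancels
  against \<open>\<psi>\<inverse>\<close>, leaving \<open>c = w\<close>, while \<open>\<rho>\<inverse>\<close> restores \<open>x\<^sub>4\<close>.  This is the device by which
  Smith showed Nagata-type automorphisms of polynomial rings to be stably tame.
\<close>

lemma free_hom_minus:
  "free_hom f (- p) = - free_hom f p"
  "free_hom f (p - q) = free_hom f p - free_hom f q"
proof -
  show *: "free_hom f (- p) = - free_hom f p" for p
    by (metis add.right_inverse free_poisson.hom_ext_simps(2,4) minus_unique)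
  show "free_hom f (p - q) = free_hom f p - free_hom f q"
    by (simp only: diff_conv_add_uminus free_poisson.hom_ext_simps *)
qed

lemma pbracket_minus_right: "\<lbrace>p, - q\<rbrace> = - \<lbrace>p, q\<rbrace>"
  by (metis add.right_inverse add_cancel_right_right free_poisson.bracket_add_right minus_unique)

lemma free_hom_comp:
  "free_hom f \<circ> free_hom g = free_hom (\<lambda>i. free_hom f (g i))"
  by (rule free_poisson.hom_ext_unique) (simp_all add: poisson_hom_def Vector_Spaces.linear_iff
      free_poisson.vector_space_axioms)

lemma free_hom_gen: "free_hom gen = id"
  by (rule free_poisson.hom_ext_unique[symmetric]) (simp_all add: poisson_hom_def
      Vector_Spaces.linear_iff free_poisson.vector_space_axioms)

lemma free_hom_in_Aut_P:
  assumes "\<And>i. free_hom f (g i) = gen i" "\<And>i. free_hom g (f i) = gen i"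
  shows "free_hom f \<in> carrier Aut_P"
proof -
  have "free_hom f \<circ> free_hom g = id" "free_hom g \<circ> free_hom f = id"
    using assms by (simp_all add: free_hom_comp free_hom_gen)
  then have "bij (free_hom f)"
    by (metis o_bij)
  then show ?thesis
    by (simp add: Aut_P_def free_poisson.poisson_hom_hom_ext)
qed

text \<open>The changes \<open>[z, c] z\<close> of \<open>x z\<close> and \<open>[z, c z]\<close> of \<open>[z, y]\<close> agree because \<open>[z, z] = 0\<close>.\<close>

lemma twist_invariant:
  "(x + \<lbrace>z, c\<rbrace>) * z - \<lbrace>z, y + c * z\<rbrace> = x * z - \<lbrace>z, y\<rbrace>"
  by (simp add: free_poisson.bracket_add_right free_poisson.leibniz free_poisson.bracket_self
      algebra_simps)

lemma poisson_subalgebra_closed: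
  assumes "poisson_subalgebra A" "p \<in> A" "q \<in> A"
  shows "p * q \<in> A" "\<lbrace>p, q\<rbrace> \<in> A" "p - q \<in> A" "- p \<in> A"
  using assms free_poisson.subspace_diff free_poisson.subspace_neg
  by (auto simp: poisson_subalgebra_def)

lemma poisson_subalgebra_hull: "poisson_subalgebra (poisson_subalgebra hull S)"
  by (rule hull_in)
    (auto simp: poisson_subalgebra_def free_poisson.subspace_def)

lemmas hull_closed = poisson_subalgebra_closed[OF poisson_subalgebra_hull]

lemma gen_in_hull: "j \<noteq> i \<Longrightarrow> gen j \<in> poisson_subalgebra hull (gen ` (UNIV - {i}))"
  by (auto intro: hull_inc)

lemma tame_comp: "\<phi> \<in> tame_auts \<Longrightarrow> \<psi> \<in> tame_auts \<Longrightarrow> \<phi> \<circ> \<psi> \<in> tame_auts"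
  using subgroup.m_closed[OF tame_auts_subgroup] by (simp add: Aut_P_def)

lemma tame_translation:
  assumes "f \<in> poisson_subalgebra hull (gen ` (UNIV - {i}))"
  shows "free_hom (gen(i := gen i + f)) \<in> tame_auts"
proof -
  have "elementary i 1 f \<in> elementary_auts"
    using assms unfolding elementary_auts_def by force
  then show ?thesis
    by (simp add: tame_auts_def elementary_def generate.incl)
qed

text \<open>The commutator construction: \<open>d\<close> is the auxiliary variable, which occurs only inside the
  commutator and is left alone by the resulting automorphism.\<close>

lemma tame_commutator:
  fixes a b c d :: 'x
  defines "w \<equiv> gen a * gen c - \<lbrace>gen c, gen b\<rbrace> :: ('k::field, 'x) free_poisson"
  assumes dist: "distinct [a, b, c, d]"
  shows "free_hom (gen(a := gen a + \<lbrace>gen c, w\<rbrace>, b := gen b + w * gen c)) \<in> tame_auts"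
proof -
  let ?t = "\<lambda>i f. free_hom (gen(i := gen i + f)) :: ('k, 'x) free_poisson \<Rightarrow> _"
  define \<psi> where "\<psi> = ?t a \<lbrace>gen c, gen d\<rbrace> \<circ> ?t b (gen d * gen c)"
  define \<psi>' where "\<psi>' = ?t a (- \<lbrace>gen c, gen d\<rbrace>) \<circ> ?t b (- (gen d * gen c))"
  have "\<psi> \<in> tame_auts" "\<psi>' \<in> tame_auts" "?t d w \<in> tame_auts" "?t d (- w) \<in> tame_auts"
    using dist unfolding \<psi>_def \<psi>'_def w_def
    by (auto intro!: tame_comp tame_translation hull_closed gen_in_hull
        simp del: add_uminus_conv_diff)
  then have "\<psi>' \<circ> (?t d w \<circ> (\<psi> \<circ> ?t d (- w))) \<in> tame_auts"
    by (intro tame_comp)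
  have \<psi>: "\<psi> = free_hom (gen(a := gen a + \<lbrace>gen c, gen d\<rbrace>, b := gen b + gen d * gen c))"
    unfolding \<psi>_def free_hom_comp
    by (rule arg_cong[where f = free_hom]) (use dist in auto)
  \<comment> \<open>Written with increment \<open>- gen d\<close>, so that \<open>twist_invariant\<close> applies to it as well.\<close>
  have \<psi>': "\<psi>' = free_hom (gen(a := gen a + \<lbrace>gen c, - gen d\<rbrace>, b := gen b + - gen d * gen c))"
    unfolding \<psi>'_def free_hom_comp
    by (rule arg_cong[where f = free_hom])
      (use dist in \<open>auto simp: pbracket_minus_right free_hom_minus\<close>)
  have \<psi>_w: "\<psi> w = w" "\<psi>' w = w"
    using dist by (auto simp: \<psi> \<psi>' w_def free_hom_minus twist_invariant simp del: mult_minus_left)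
  have \<rho>_w: "?t d p w = w" for p
    using dist by (simp add: w_def free_hom_minus)
  have "\<psi>' \<circ> (?t d w \<circ> (\<psi> \<circ> ?t d (- w))) =
      free_hom (gen(a := gen a + \<lbrace>gen c, w\<rbrace>, b := gen b + w * gen c))"
    unfolding \<psi> \<psi>' free_hom_comp
    by (rule arg_cong[where f = free_hom], rule ext)
      (use dist \<psi>_w[unfolded \<psi> \<psi>'] \<rho>_w in \<open>auto simp: free_hom_minus pbracket_minus_right
        free_poisson.bracket_add_right algebra_simps\<close>)
  with \<open>\<psi>' \<circ> _ \<in> tame_auts\<close> show ?thesis
    by simp
qed

theorem mainTheorem2:
  fixes \<delta> :: "('k::field, 3) free_poisson \<Rightarrow> ('k, 3) free_poisson"
  assumes "\<delta> = free_hom (tuple3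
      (gen 1 + \<lbrace>gen 3, gen 1 * gen 3 - \<lbrace>gen 3, gen 2\<rbrace>\<rbrace>)
      (gen 2 + (gen 1 * gen 3 - \<lbrace>gen 3, gen 2\<rbrace>) * gen 3)
      (gen 3))"
  shows "\<delta> \<in> carrier Aut_P \<and>
    free_hom (tuple4 (incl (\<delta> (gen 1))) (incl (\<delta> (gen 2))) (gen 3) (gen 4)) \<in> tame_auts"
proof
  define w :: "('k, 3) free_poisson" where "w = gen 1 * gen 3 - \<lbrace>gen 3, gen 2\<rbrace>"
  define \<theta> :: "('k, 3) free_poisson \<Rightarrow> 3 \<Rightarrow> ('k, 3) free_poisson" where
    "\<theta> c = tuple3 (gen 1 + \<lbrace>gen 3, c\<rbrace>) (gen 2 + c * gen 3) (gen 3)" for c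
  have \<delta>: "\<delta> = free_hom (\<theta> w)"
    using assms by (simp add: \<theta>_def w_def)
  have \<theta>_simps: "\<theta> c 1 = gen 1 + \<lbrace>gen 3, c\<rbrace>" "\<theta> c 2 = gen 2 + c * gen 3" "\<theta> c 3 = gen 3" for c
    by (simp_all add: \<theta>_def)
  have fix_w: "free_hom (\<theta> c) w = w" for c
    by (simp add: \<theta>_simps w_def free_hom_minus twist_invariant)
  have inverse: "free_hom (\<theta> w) (\<theta> (- w) i) = gen i" "free_hom (\<theta> (- w)) (\<theta> w i) = gen i" for i
    using exhaust_index3[of i] fix_w
    by (auto simp: \<theta>_simps free_hom_minus pbracket_minus_right)
  show "\<delta> \<in> carrier Aut_P"
    unfolding \<delta> by (rule free_hom_in_Aut_P[OF inverse])
  define v :: "('k, 4) free_poisson" where "v = gen 1 * gen 3 - \<lbrace>gen 3, gen 2\<rbrace>"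
  have "tuple4 (incl (\<delta> (gen 1))) (incl (\<delta> (gen 2))) (gen 3) (gen 4) =
      gen(1 := gen 1 + \<lbrace>gen 3, v\<rbrace>, 2 := gen 2 + v * gen 3)" (is "?l = ?r")
  proof
    fix i show "?l i = ?r i"
      using exhaust_index4[of i]
      by (auto simp: assms v_def incl_def free_hom_minus)
  qed
  then show "free_hom (tuple4 (incl (\<delta> (gen 1))) (incl (\<delta> (gen 2))) (gen 3) (gen 4)) \<in> tame_auts"
    using tame_commutator[of 1 2 3 "4 :: 4"] by (simp add: v_def)
qed

end
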